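(* Suppose that for all $u\in U$ the matrix $\nabla_x^2 f(x^*(u),u)$ is positive definite, and that the map $D(\nabla_x f)$ is Lipschitz continuous on $Z$ with constant $C\ge 0$. Let $u\in U$, $s\in\mathbb R^P$, $r\in\mathbb R^N$, $0<\alpha\le 1/L(u)$; let $(x^{(k)})$ be generated by $x^{(k+1)}=x^{(k)}-\alpha\nabla_x f(x^{(k)},u)$ with $x^{(0)}=a$, and let $K\in\mathbb N$ be sufficiently large that $x^{(K)}\in B_{\varepsilon(u)}(x^*(u))$. Put $R:=I-\alpha\nabla_x^2 f(x^{(K)},u)$. Let $(\hat x^{(k)})_{k\in\mathbb N}$ be generated by $$\hat x^{(k+1)}=R\,\hat x^{(k)}-\alpha\nabla_{xu}f(x^{(K)},u)\,s,\qquad \hat x^{(0)}=0,$$ and let $(\tilde u^{(K)}_n)_{n\in\mathbb N}$ be generated by $$\tilde u^{(K)}_{n+1}=\tilde u^{(K)}_n-\alpha\,\tilde x^{(K-n)}\nabla_{xu}f(x^{(K)},u),\qquad \tilde x^{(K-n-1)}=\tilde x^{(K-n)}R,$$ with $\tilde u^{(K)}_0=0$ and $\tilde x^{(K)}=r^T$. Then $\hat x^{(k)}\to\varphi(x^{(K)},u)s$ as $k\to\infty$ and $\tilde u_n^{(K)}\to r^T\varphi(x^{(K)},u)$ as $n\to\infty$, and there exists $q_{GD}\in[0,1)$ such that for all $k,n\in\mathbb N$, $$\|\hat x^{(k)}-\varphi(x^{(K)},u)s\|\le q_{GD}^{\,k}\,\frac{\kappa}{m(u)}\|s\|\quad\text{and}\quad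 \|\tilde u^{(K)}_n-r^T\varphi(x^{(K)},u)\|\le q_{GD}^{\,n}\,\frac{\kappa}{m(u)}\|r\| .$$
   Context: Let $N,P\in\mathbb N$, let $U\subset\mathbb R^P$ be open, non-empty and bounded, and let $f:\mathbb R^N\times\mathbb R^P\to\mathbb R$ be twice continuously differentiable on $\mathbb R^N\times U$. For every $u\in U$ the function $f(\cdot,u)$ is convex and has a unique minimizer over $\mathbb R^N$, denoted $x^*(u)$. $\nabla_x f$ is the gradient in $x$, $\nabla_x^2 f$ the $N\times N$ Hessian in $x$, $\nabla_{xu}f$ the $N\times P$ matrix of derivatives of $\nabla_x f$ with respect to $u$, and $D(\nabla_x f)$ the total derivative of $\nabla_x f$ with respect to $(x,u)$. Norms are Euclidean norms and the induced operator norms. Positive definiteness of $\nabla_x^2 f(x^*(u),u)$ gives, for each $u\in U$, numbers $\varepsilon(u)>0$ and $m(u)>0$ such that $f(\cdot,u)$ is $m(u)$-strongly convex on the closed ball $B_{\varepsilon(u)}(x^*(u))$; these are fixed. A point $a\in\mathbb R^N$ is fixed such that for every $u\in U$ the (bounded) level set $X(u):=\{x\in\mathbb R^N: f(x,u)\le f(a,u)\}$ contains $B_{\varepsilon(u)}(x^*(u))$. Set $Z:=\{(x,u)\in\mathbb R^N\times U: x\in X(u)\}$. $L(u)>0$ is an upper bound on the maximum eigenvalue of $\nabla_x^2 f(x,u)$ over $x\in X(u)$. $\kappa>0$ is an upper bound for $\|\nabla_{xu}f(x,u)\|$ over $(x,u)\in Z$. For $u\in U$ and $x\in B_{\varepsilon(u)}(x^*(u))$,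 $$\varphi(x,u):=-\nabla_x^2 f(x,u)^{-1}\nabla_{xu}f(x,u)\in\mathbb R^{N\times P}.$$ The index $K-n$ of the row vectors $\tilde x^{(K-n)}$ may become negative (the recursion is continued for all $n\in\mathbb N$ with $x^{(K)}$ fixed). *)

theory Defs
  imports "HOL-Analysis.Analysis"
begin

(* Meant for open S, where the derivatives "at z" are derivatives of the restriction to S. *)
definition C2_on :: "'a::real_normed_vector set \<Rightarrow> ('a \<Rightarrow> 'b::real_normed_vector) \<Rightarrow> bool" where
  "C2_on S f \<longleftrightarrow>
     (\<exists>(f' :: 'a \<Rightarrow> 'a \<Rightarrow>\<^sub>L 'b) (f'' :: 'a \<Rightarrow> 'a \<Rightarrow>\<^sub>L ('a \<Rightarrow>\<^sub>L 'b)).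
        (\<forall>z\<in>S. (f has_derivative blinfun_apply (f' z)) (at z)) \<and>
        (\<forall>z\<in>S. (f' has_derivative blinfun_apply (f'' z)) (at z)) \<and>
        continuous_on S f'')"

definition strongly_convex_on :: "real \<Rightarrow> 'a::real_inner set \<Rightarrow> ('a \<Rightarrow> real) \<Rightarrow> bool" where
  "strongly_convex_on \<mu> S g \<longleftrightarrow> convex S \<and>
     (\<forall>x\<in>S. \<forall>y\<in>S. \<forall>t\<in>{0..1}.
        g (t *\<^sub>R x + (1 - t) *\<^sub>R y)
          \<le> t * g x + (1 - t) * g y - \<mu> / 2 * t * (1 - t) * (norm (x - y))\<^sup>2)"

(* Symmetry is not required here: the definition is applied to Hessians of C2 functions. *)
definition positive_definite :: "real^'n^'n \<Rightarrow> bool" where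
  "positive_definite A \<longleftrightarrow> (\<forall>v. v \<noteq> 0 \<longrightarrow> 0 < v \<bullet> (A *v v))"

definition is_eigenvalue :: "real^'n^'n \<Rightarrow> real \<Rightarrow> bool" where
  "is_eigenvalue A l \<longleftrightarrow> (\<exists>v. v \<noteq> 0 \<and> A *v v = l *\<^sub>R v)"

definition matrix_opnorm :: "real^'n^'m \<Rightarrow> real" where
  "matrix_opnorm A = onorm (\<lambda>v. A *v v)"

definition grad_x :: "((real^'n) \<times> (real^'p) \<Rightarrow> real) \<Rightarrow> real^'n \<Rightarrow> real^'p \<Rightarrow> real^'n" where
  "grad_x f x u = (THE D. GDERIV (\<lambda>y. f (y, u)) x :> D)"

definition hess_x :: "((real^'n) \<times> (real^'p) \<Rightarrow> real) \<Rightarrow> real^'n \<Rightarrow> real^'p \<Rightarrow> real^'n^'n" where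
  "hess_x f x u = jacobian (\<lambda>y. grad_x f y u) (at x)"

definition hess_xu :: "((real^'n) \<times> (real^'p) \<Rightarrow> real) \<Rightarrow> real^'n \<Rightarrow> real^'p \<Rightarrow> real^'p^'n" where
  "hess_xu f x u = jacobian (\<lambda>v. grad_x f x v) (at u)"

(* As a bounded linear map, so that distances between values are operator-norm distances. *)
definition D_grad_x ::
    "((real^'n) \<times> (real^'p) \<Rightarrow> real) \<Rightarrow> (real^'n) \<times> (real^'p) \<Rightarrow> ((real^'n) \<times> (real^'p)) \<Rightarrow>\<^sub>L (real^'n)" where
  "D_grad_x f z = Blinfun (frechet_derivative (\<lambda>(x, u). grad_x f x u) (at z))"

definition minimizer :: "((real^'n) \<times> (real^'p) \<Rightarrow> real) \<Rightarrow> real^'p \<Rightarrow> real^'n" where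
  "minimizer f u = arg_min (\<lambda>x. f (x, u)) (\<lambda>_. True)"

definition level_set :: "((real^'n) \<times> (real^'p) \<Rightarrow> real) \<Rightarrow> real^'n \<Rightarrow> real^'p \<Rightarrow> (real^'n) set" where
  "level_set f a u = {x. f (x, u) \<le> f (a, u)}"

definition level_graph ::
    "((real^'n) \<times> (real^'p) \<Rightarrow> real) \<Rightarrow> real^'n \<Rightarrow> (real^'p) set \<Rightarrow> ((real^'n) \<times> (real^'p)) set" where
  "level_graph f a U = {(x, u). u \<in> U \<and> x \<in> level_set f a u}"

definition phi :: "((real^'n) \<times> (real^'p) \<Rightarrow> real) \<Rightarrow> real^'n \<Rightarrow> real^'p \<Rightarrow> real^'p^'n" where
  "phi f x u = - (matrix_inv (hess_x f x u) ** hess_xu f x u)"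

end

(* The Hessian H = hess_x f (x K) u is symmetric with m I <= H <= L I, so R = I - \<alpha> H is
   symmetric with 0 <= R <= (1 - \<alpha> m) I and hence contracts by q = 1 - \<alpha> m.  Since
   \<phi> = -H^-1 B with B = hess_xu f (x K) u, one has \<alpha> B = -\<alpha> H \<phi> = -(I - R) \<phi>, so that
   xhat k - \<phi> s evolves by R, while utilde n - r \<phi> = -(r R^n) \<phi>.  Both errors are therefore at most
   q^k times the norm of \<phi>, and this norm is at most \<kappa>/m. *)

theory Submission
  imports Defs
begin

section \<open>Self-adjoint positive semidefinite operators\<close>

text \<open>The form \<open>v \<bullet> T w\<close> is a possibly degenerate inner product, so the
  usual discriminant argument applies: the quadratic
  \<open>t \<mapsto> (v + t w) \<bullet> T (v + t w)\<close> never becomes negative.\<close>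

lemma selfadjoint_cauchy_schwarz:
  fixes T :: "'a::real_inner \<Rightarrow> 'a"
  assumes lin: "linear T"
    and sym: "\<And>v w. v \<bullet> T w = w \<bullet> T v"
    and pos: "\<And>v. 0 \<le> v \<bullet> T v"
  shows "(v \<bullet> T w)\<^sup>2 \<le> (v \<bullet> T v) * (w \<bullet> T w)"
proof -
  define a b c where "a = v \<bullet> T v" and "b = v \<bullet> T w" and "c = w \<bullet> T w"
  have quad: "0 \<le> a + 2 * t * b + t\<^sup>2 * c" for t
  proof -
    have "(v + t *\<^sub>R w) \<bullet> T (v + t *\<^sub>R w) = a + 2 * t * b + t\<^sup>2 * c"
      using sym[of w v] unfolding a_def b_def c_def
      by (simp add: linear_add[OF lin] linear_scale[OF lin] inner_add_left inner_add_right
          power2_eq_square algebra_simps)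
    then show ?thesis using pos by metis
  qed
  have "c \<ge> 0" using pos by (simp add: c_def)
  have "b\<^sup>2 \<le> a * c"
  proof (cases "c = 0")
    case True
    have "b = 0"
    proof (rule ccontr)
      \<comment> \<open>With \<open>c = 0\<close> the quadratic is affine in \<open>t\<close>; the
        chosen \<open>t\<close> makes its value -1.\<close>
      assume "b \<noteq> 0"
      then have "2 * (- (a + 1) / (2 * b)) * b = - a - 1" by (simp add: field_simps)
      moreover have "0 \<le> a + 2 * (- (a + 1) / (2 * b)) * b"
        using quad[of "- (a + 1) / (2 * b)"] unfolding True mult_zero_right add_0_right .
      ultimately show False by linarith
    qed
    then show ?thesis using True by simp
  next
    case False
    then have "c > 0" using \<open>c \<ge> 0\<close> by simp
    have "a + 2 * (- b / c) * b + (- b / c)\<^sup>2 * c = a - b\<^sup>2 / c"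
      using False by (simp add: field_simps power2_eq_square)
    then have "b\<^sup>2 / c \<le> a" using quad[of "- b / c"] by linarith
    then show ?thesis using \<open>c > 0\<close> by (simp add: field_simps)
  qed
  then show ?thesis by (simp add: a_def b_def c_def)
qed

text \<open>Cauchy-Schwarz for the form of \<open>T\<close>, applied to \<open>T v\<close> and
  \<open>v\<close>, bounds the fourth power of \<open>norm (T v)\<close> by the squares of
  \<open>q\<close>, \<open>norm (T v)\<close> and \<open>norm v\<close>; cancelling the square of
  \<open>norm (T v)\<close> leaves the claim. A two-sided bound on the quadratic form thus controls
  the operator norm without any diagonalization.\<close>

lemma selfadjoint_contraction:
  fixes T :: "'a::real_inner \<Rightarrow> 'a"
  assumes lin: "linear T"
    and sym: "\<And>v w. v \<bullet> T w = w \<bullet> T v"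
    and pos: "\<And>v. 0 \<le> v \<bullet> T v"
    and le: "\<And>v. v \<bullet> T v \<le> q * (norm v)\<^sup>2"
    and "0 \<le> q"
  shows "norm (T v) \<le> q * norm v"
proof (cases "T v = 0")
  case True
  then show ?thesis using \<open>0 \<le> q\<close> by simp
next
  case False
  have "((norm (T v))\<^sup>2)\<^sup>2 = (T v \<bullet> T v)\<^sup>2"
    by (simp add: power2_norm_eq_inner)
  also have "\<dots> \<le> (T v \<bullet> T (T v)) * (v \<bullet> T v)"
    by (rule selfadjoint_cauchy_schwarz[OF lin sym pos])
  also have "\<dots> \<le> (q * (norm (T v))\<^sup>2) * (q * (norm v)\<^sup>2)"
    by (intro mult_mono le pos mult_nonneg_nonneg \<open>0 \<le> q\<close>) auto
  also have "\<dots> = (norm (T v))\<^sup>2 * (q * norm v)\<^sup>2"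
    by (simp add: power2_eq_square)
  finally have "(norm (T v))\<^sup>2 * (norm (T v))\<^sup>2 \<le> (norm (T v))\<^sup>2 * (q * norm v)\<^sup>2"
    by (simp only: power2_eq_square)
  moreover have "0 < (norm (T v))\<^sup>2" using False by simp
  ultimately have "(norm (T v))\<^sup>2 \<le> (q * norm v)\<^sup>2"
    using mult_le_cancel_left_pos by blast
  then show ?thesis
    using \<open>0 \<le> q\<close> by (meson mult_nonneg_nonneg norm_ge_zero power2_le_imp_le)
qed

text \<open>The maximum of the Rayleigh quotient over the unit sphere is an eigenvalue. This links
  an assumption on eigenvalues to a bound on the quadratic form.\<close>

lemma symmetric_matrix_top_eigenvalue:
  fixes A :: "real^'n^'n"
  assumes sym: "\<And>v w. v \<bullet> (A *v w) = w \<bullet> (A *v v)"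
  obtains l where "is_eigenvalue A l" and "\<And>v. v \<bullet> (A *v v) \<le> l * (norm v)\<^sup>2"
proof -
  have "continuous_on (sphere 0 1) (\<lambda>v. v \<bullet> (A *v v))"
    by (intro continuous_intros)
  moreover have "sphere (0::real^'n) 1 \<noteq> {}"
    by simp
  ultimately obtain w where w: "w \<in> sphere 0 1"
    and max: "\<And>v. v \<in> sphere 0 1 \<Longrightarrow> v \<bullet> (A *v v) \<le> w \<bullet> (A *v w)"
    using continuous_attains_sup[OF compact_sphere] by blast
  define l where "l = w \<bullet> (A *v w)"
  have bound: "v \<bullet> (A *v v) \<le> l * (norm v)\<^sup>2" for v
  proof (cases "v = 0")
    case False
    have "(v /\<^sub>R norm v) \<bullet> (A *v (v /\<^sub>R norm v)) \<le> l"
      unfolding l_def using False by (intro max) simp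
    then show ?thesis
      using False by (simp add: matrix_vector_mult_scaleR field_simps power2_eq_square)
  qed simp
  \<comment> \<open>By maximality of \<open>w\<close>, the operator \<open>T\<close> is positive
    semidefinite and its form vanishes at \<open>w\<close>. Cauchy-Schwarz for the pair
    \<open>T w\<close>, \<open>w\<close> then forces \<open>T w = 0\<close>, the eigenvalue
    equation.\<close>
  define T where "T v = l *\<^sub>R v - A *v v" for v
  have lin: "linear T"
    unfolding T_def by (intro linear_compose_sub linear_compose_scale_right linear_id[unfolded id_def]
        matrix_vector_mul_linear)
  have symT: "v \<bullet> T z = z \<bullet> T v" for v z
    using sym[of v z] by (simp add: T_def inner_diff_right inner_commute)
  have pos: "0 \<le> v \<bullet> T v" for v
    using bound[of v] by (simp add: T_def inner_diff_right power2_norm_eq_inner)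
  have "w \<bullet> w = 1"
    using w by (simp add: dot_square_norm)
  then have "w \<bullet> T w = 0"
    by (simp add: T_def inner_diff_right l_def)
  then have "(T w \<bullet> T w)\<^sup>2 \<le> 0"
    using selfadjoint_cauchy_schwarz[OF lin symT pos, of "T w" w] by simp
  then have "T w = 0" by simp
  then have "A *v w = l *\<^sub>R w" by (simp add: T_def)
  moreover have "w \<noteq> 0" using w by auto
  ultimately have "is_eigenvalue A l" unfolding is_eigenvalue_def by blast
  then show ?thesis using bound that by blast
qed

section \<open>Symmetry of the second derivative\<close>

text \<open>The mean value theorem along \<open>v\<close> turns the second difference into
  \<open>t\<close> times \<open>v\<close> paired with a difference of gradients at two points
  \<open>t *\<^sub>R w\<close> apart; linearizing \<open>G\<close> at \<open>x\<close> evaluates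
  that difference up to o(t).\<close>

lemma second_difference_tendsto:
  fixes g :: "'a::real_inner \<Rightarrow> real"
  assumes grad: "\<And>y. GDERIV g y :> G y"
    and hess: "(G has_derivative H) (at x)"
  shows "((\<lambda>t. (g (x + t *\<^sub>R v + t *\<^sub>R w) - g (x + t *\<^sub>R v) - g (x + t *\<^sub>R w) + g x) / t\<^sup>2)
           \<longlongrightarrow> v \<bullet> H w) (at_right 0)"
proof (rule tendstoI)
  fix e :: real assume "0 < e"
  \<comment> \<open>The summand 1 makes \<open>N\<close> positive and keeps both evaluation points
    strictly within \<open>t * N\<close> of \<open>x\<close>. The total error is at most 2 e' N^2,
    which the choice of \<open>e'\<close> turns into \<open>e / 2\<close>.\<close>
  define N where "N = norm v + norm w + 1"
  have "N > 0" unfolding N_def by (simp add: add_nonneg_pos)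
  define e' where "e' = e / (4 * N\<^sup>2)"
  have "e' > 0" using \<open>0 < e\<close> \<open>N > 0\<close> by (simp add: e'_def)
  have lin: "linear H"
    using hess has_derivative_linear by blast
  obtain d where "d > 0"
    and d: "\<And>y. norm (y - x) < d \<Longrightarrow> norm (G y - G x - H (y - x)) \<le> e' * norm (y - x)"
    using hess \<open>e' > 0\<close> unfolding has_derivative_at_alt by blast
  have close: "dist ((g (x + t *\<^sub>R v + t *\<^sub>R w) - g (x + t *\<^sub>R v) - g (x + t *\<^sub>R w) + g x) / t\<^sup>2)
                 (v \<bullet> H w) < e"
    if "0 < t" "t < d / N" for t
  proof -
    \<comment> \<open>The second difference is \<open>p t - p 0\<close>, the change of the
      \<open>w\<close>-increment as its base point moves along \<open>v\<close>.\<close>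
    define p where "p s = g (x + s *\<^sub>R v + t *\<^sub>R w) - g (x + s *\<^sub>R v)" for s
    have dp: "(p has_derivative
        (\<lambda>h. h * (v \<bullet> (G (x + s *\<^sub>R v + t *\<^sub>R w) - G (x + s *\<^sub>R v))))) (at s within {0..t})" for s
    proof -
      have 1: "((\<lambda>s. x + s *\<^sub>R v + t *\<^sub>R w) has_derivative (\<lambda>h. h *\<^sub>R v)) (at s within {0..t})"
        and 2: "((\<lambda>s. x + s *\<^sub>R v) has_derivative (\<lambda>h. h *\<^sub>R v)) (at s within {0..t})"
        by (auto intro!: derivative_eq_intros)
      have "((\<lambda>s. g (x + s *\<^sub>R v + t *\<^sub>R w)) has_derivative
          (\<lambda>h. (h *\<^sub>R v) \<bullet> G (x + s *\<^sub>R v + t *\<^sub>R w))) (at s within {0..t})"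
        using has_derivative_compose[OF 1 grad[unfolded gderiv_def]] by simp
      moreover have "((\<lambda>s. g (x + s *\<^sub>R v)) has_derivative
          (\<lambda>h. (h *\<^sub>R v) \<bullet> G (x + s *\<^sub>R v))) (at s within {0..t})"
        using has_derivative_compose[OF 2 grad[unfolded gderiv_def]] by simp
      ultimately show ?thesis
        unfolding p_def
        by (auto dest: has_derivative_diff simp: inner_diff_right right_diff_distrib)
    qed
    obtain \<xi> where \<xi>: "\<xi> \<in> {0<..<t}"
      and "p t - p 0 = (t - 0) * (v \<bullet> (G (x + \<xi> *\<^sub>R v + t *\<^sub>R w) - G (x + \<xi> *\<^sub>R v)))"
      using mvt_simple[OF \<open>0 < t\<close> dp] by blast
    then have mv: "g (x + t *\<^sub>R v + t *\<^sub>R w) - g (x + t *\<^sub>R v) - g (x + t *\<^sub>R w) + g x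
        = t * (v \<bullet> (G (x + \<xi> *\<^sub>R v + t *\<^sub>R w) - G (x + \<xi> *\<^sub>R v)))"
      by (simp add: p_def)
    \<comment> \<open>Both points are close enough to \<open>x\<close> for the linearization there.
      The linear parts differ exactly by \<open>t *\<^sub>R H w\<close>, so the unknown
      \<open>\<xi>\<close> drops out.\<close>
    define y1 y2 where "y1 = x + \<xi> *\<^sub>R v + t *\<^sub>R w" and "y2 = x + \<xi> *\<^sub>R v"
    have "\<xi> * norm v \<le> t * norm v" using \<xi> by (intro mult_right_mono) auto
    moreover have "norm (y1 - x) \<le> \<xi> * norm v + t * norm w"
      unfolding y1_def using \<xi> that norm_triangle_ineq[of "\<xi> *\<^sub>R v" "t *\<^sub>R w"]
      by (simp add: algebra_simps)
    moreover have "norm (y2 - x) = \<xi> * norm v"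
      unfolding y2_def using \<xi> by simp
    moreover have "t * norm v + t * norm w < t * N" and "0 \<le> t * norm w"
      using that by (simp_all add: N_def algebra_simps)
    moreover have "t * N < d" using that \<open>N > 0\<close> by (simp add: field_simps)
    ultimately have y1: "norm (y1 - x) < t * N" "norm (y1 - x) < d"
      and y2: "norm (y2 - x) < t * N" "norm (y2 - x) < d"
      by linarith+
    have "y1 - x = (y2 - x) + t *\<^sub>R w" by (simp add: y1_def y2_def)
    then have Hy: "H (y1 - x) = H (y2 - x) + t *\<^sub>R H w"
      by (simp only: linear_add[OF lin] linear_scale[OF lin])
    have "G y1 - G y2 - t *\<^sub>R H w = (G y1 - G x - H (y1 - x)) - (G y2 - G x - H (y2 - x))"
      using Hy by simp
    then have "norm (G y1 - G y2 - t *\<^sub>R H w)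
        \<le> norm (G y1 - G x - H (y1 - x)) + norm (G y2 - G x - H (y2 - x))"
      by (metis norm_triangle_ineq4)
    also have "\<dots> \<le> e' * norm (y1 - x) + e' * norm (y2 - x)"
      using d[OF y1(2)] d[OF y2(2)] by linarith
    also have "\<dots> \<le> e' * (t * N) + e' * (t * N)"
      using y1(1) y2(1) \<open>e' > 0\<close> by (intro add_mono mult_left_mono) auto
    finally have err: "norm (G y1 - G y2 - t *\<^sub>R H w) \<le> 2 * e' * t * N" by (simp add: mult_ac)
    have "t * (v \<bullet> (G y1 - G y2)) / t\<^sup>2 - v \<bullet> H w = (v \<bullet> (G y1 - G y2 - t *\<^sub>R H w)) / t"
      using that by (simp add: inner_diff_right inner_scaleR_right diff_divide_distrib power2_eq_square)
    then have "\<bar>t * (v \<bullet> (G y1 - G y2)) / t\<^sup>2 - v \<bullet> H w\<bar> = \<bar>v \<bullet> (G y1 - G y2 - t *\<^sub>R H w)\<bar> / t"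
      using that by simp
    also have "\<dots> \<le> (norm v * norm (G y1 - G y2 - t *\<^sub>R H w)) / t"
      using that by (intro divide_right_mono Cauchy_Schwarz_ineq2) auto
    also have "\<dots> \<le> (N * (2 * e' * t * N)) / t"
      using that err by (intro divide_right_mono mult_mono) (auto simp: N_def)
    also have "\<dots> = e / 2"
      using that \<open>N > 0\<close> by (simp add: e'_def power2_eq_square field_simps)
    also have "\<dots> < e" using \<open>0 < e\<close> by simp
    finally show ?thesis
      by (simp add: mv dist_real_def y1_def y2_def)
  qed
  have "d / N > 0" using \<open>d > 0\<close> \<open>N > 0\<close> by simp
  then show "\<forall>\<^sub>F t in at_right 0. dist ((g (x + t *\<^sub>R v + t *\<^sub>R w) - g (x + t *\<^sub>R v)
      - g (x + t *\<^sub>R w) + g x) / t\<^sup>2) (v \<bullet> H w) < e"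
    unfolding eventually_at_right_field using close by blast
qed

text \<open>The second difference is unchanged when \<open>v\<close> and \<open>w\<close> are
  exchanged, so its two limits agree.\<close>

lemma second_derivative_symmetric:
  fixes g :: "'a::real_inner \<Rightarrow> real"
  assumes "\<And>y. GDERIV g y :> G y" and "(G has_derivative H) (at x)"
  shows "v \<bullet> H w = w \<bullet> H v"
proof (rule tendsto_unique)
  show "((\<lambda>t. (g (x + t *\<^sub>R v + t *\<^sub>R w) - g (x + t *\<^sub>R v) - g (x + t *\<^sub>R w) + g x) / t\<^sup>2)
          \<longlongrightarrow> v \<bullet> H w) (at_right 0)"
    by (rule second_difference_tendsto[OF assms])
  have "x + t *\<^sub>R w + t *\<^sub>R v = x + t *\<^sub>R v + t *\<^sub>R w" for t
    by (simp add: algebra_simps)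
  then show "((\<lambda>t. (g (x + t *\<^sub>R v + t *\<^sub>R w) - g (x + t *\<^sub>R v) - g (x + t *\<^sub>R w) + g x) / t\<^sup>2)
          \<longlongrightarrow> w \<bullet> H v) (at_right 0)"
    using second_difference_tendsto[OF assms, of w v] by (simp add: algebra_simps)
qed (rule trivial_limit_at_right_real)

section \<open>From strong convexity to a lower bound on the Hessian\<close>

text \<open>The limit is taken from the right because the convexity inequalities below are divided
  by a positive \<open>t\<close>.\<close>

lemma has_derivative_directional_tendsto:
  fixes F :: "'a::real_normed_vector \<Rightarrow> 'b::real_normed_vector"
  assumes "(F has_derivative F') (at y)"
  shows "((\<lambda>t. (1 / t) *\<^sub>R (F (y + t *\<^sub>R v) - F y)) \<longlongrightarrow> F' v) (at_right 0)"
proof -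
  have "((\<lambda>t. y + t *\<^sub>R v) has_derivative (\<lambda>h. h *\<^sub>R v)) (at 0)"
    by (auto intro!: derivative_eq_intros)
  then have "((\<lambda>t. F (y + t *\<^sub>R v)) has_derivative (\<lambda>h. F' (h *\<^sub>R v))) (at 0)"
    by (rule has_derivative_compose) (simp add: assms)
  then have "((\<lambda>t. F (y + t *\<^sub>R v)) has_vector_derivative F' v) (at 0)"
    unfolding has_vector_derivative_def
    by (simp add: linear_scale[OF has_derivative_linear[OF assms]])
  then have "((\<lambda>t. F (y + t *\<^sub>R v)) has_vector_derivative F' v) (at_right 0)"
    by (rule has_vector_derivative_at_within)
  then have "((\<lambda>t. (1 / \<bar>t\<bar>) *\<^sub>R (F (y + t *\<^sub>R v) - (F y + t *\<^sub>R F' v))) \<longlongrightarrow> 0) (at_right 0)"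
    unfolding has_vector_derivative_def has_derivative_within by simp
  moreover have "\<forall>\<^sub>F t in at_right 0. (1 / \<bar>t\<bar>) *\<^sub>R (F (y + t *\<^sub>R v) - (F y + t *\<^sub>R F' v))
      = (1 / t) *\<^sub>R (F (y + t *\<^sub>R v) - F y) - F' v"
    by (rule eventually_mono[OF eventually_at_right_less]) (simp add: scaleR_diff_right scaleR_add_right)
  ultimately have "((\<lambda>t. (1 / t) *\<^sub>R (F (y + t *\<^sub>R v) - F y) - F' v) \<longlongrightarrow> 0) (at_right 0)"
    by (rule Lim_transform_eventually)
  then show ?thesis by (simp add: LIM_zero_iff)
qed

text \<open>Divide the strong convexity inequality on the segment from \<open>y\<close> to
  \<open>x\<close> by \<open>t\<close> and let \<open>t\<close> tend to 0.\<close>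

lemma strongly_convex_above_tangent:
  fixes g :: "'a::real_inner \<Rightarrow> real"
  assumes grad: "GDERIV g y :> G"
    and sc: "strongly_convex_on \<mu> S g" and "x \<in> S" "y \<in> S"
  shows "g y + (x - y) \<bullet> G + \<mu> / 2 * (norm (x - y))\<^sup>2 \<le> g x"
proof -
  have "((\<lambda>t. (1 / t) *\<^sub>R (g (y + t *\<^sub>R (x - y)) - g y)) \<longlongrightarrow> (x - y) \<bullet> G) (at_right 0)"
    by (rule has_derivative_directional_tendsto[OF grad[unfolded gderiv_def]])
  moreover have "((\<lambda>t. g x - g y - \<mu> / 2 * (1 - t) * (norm (x - y))\<^sup>2) \<longlongrightarrow>
      g x - g y - \<mu> / 2 * (1 - 0) * (norm (x - y))\<^sup>2) (at_right 0)"
    by (intro tendsto_intros)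
  moreover have "\<forall>\<^sub>F t in at_right 0. (1 / t) *\<^sub>R (g (y + t *\<^sub>R (x - y)) - g y)
      \<le> g x - g y - \<mu> / 2 * (1 - t) * (norm (x - y))\<^sup>2"
    unfolding eventually_at_right_field
  proof (intro exI[of _ 1] conjI allI impI)
    fix t :: real assume t: "0 < t" "t < 1"
    have "y + t *\<^sub>R (x - y) = t *\<^sub>R x + (1 - t) *\<^sub>R y" by (simp add: algebra_simps)
    then have "g (y + t *\<^sub>R (x - y)) \<le>
        t * g x + (1 - t) * g y - \<mu> / 2 * t * (1 - t) * (norm (x - y))\<^sup>2"
      using sc t assms(3,4) unfolding strongly_convex_on_def by simp
    also have "\<dots> = g y + t * (g x - g y - \<mu> / 2 * (1 - t) * (norm (x - y))\<^sup>2)"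
      by (simp add: algebra_simps)
    finally show "(1 / t) *\<^sub>R (g (y + t *\<^sub>R (x - y)) - g y)
        \<le> g x - g y - \<mu> / 2 * (1 - t) * (norm (x - y))\<^sup>2"
      using t by (simp add: pos_divide_le_eq mult.commute)
  qed simp
  ultimately have "(x - y) \<bullet> G \<le> g x - g y - \<mu> / 2 * (1 - 0) * (norm (x - y))\<^sup>2"
    using tendsto_le trivial_limit_at_right_real by blast
  then show ?thesis by simp
qed

text \<open>Adding the tangent inequalities at two points gives strong monotonicity of
  \<open>G\<close>. Applied at \<open>x\<close> and \<open>x + t *\<^sub>R v\<close>, divided by the
  square of \<open>t\<close>, it becomes the Hessian bound in the limit. Interiority keeps
  \<open>x + t *\<^sub>R v\<close> in \<open>S\<close> for small \<open>t\<close>, whatever the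
  direction.\<close>

lemma strongly_convex_hessian_ge_interior:
  fixes g :: "'a::real_inner \<Rightarrow> real"
  assumes grad: "\<And>y. GDERIV g y :> G y"
    and sc: "strongly_convex_on \<mu> S g"
    and x: "x \<in> interior S"
    and hess: "(G has_derivative H) (at x)"
  shows "\<mu> * (norm v)\<^sup>2 \<le> v \<bullet> H v"
proof -
  have mono: "\<mu> * (norm (z - x))\<^sup>2 \<le> (z - x) \<bullet> (G z - G x)" if "z \<in> S" for z
  proof -
    have "x \<in> S" using x interior_subset by blast
    have "g x + (z - x) \<bullet> G x + \<mu> / 2 * (norm (z - x))\<^sup>2 \<le> g z"
      and "g z + (x - z) \<bullet> G z + \<mu> / 2 * (norm (z - x))\<^sup>2 \<le> g x"
      using strongly_convex_above_tangent[OF grad sc] \<open>x \<in> S\<close> that by (metis norm_minus_commute)+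
    moreover have "(x - z) \<bullet> G z = - ((z - x) \<bullet> G z)"
      by (metis inner_minus_left minus_diff_eq)
    ultimately show ?thesis by (simp add: inner_diff_right)
  qed
  have "((\<lambda>t. v \<bullet> ((1 / t) *\<^sub>R (G (x + t *\<^sub>R v) - G x))) \<longlongrightarrow> v \<bullet> H v) (at_right 0)"
    by (intro tendsto_intros has_derivative_directional_tendsto hess)
  moreover have "\<forall>\<^sub>F t in at_right 0. \<mu> * (norm v)\<^sup>2 \<le> v \<bullet> ((1 / t) *\<^sub>R (G (x + t *\<^sub>R v) - G x))"
  proof -
    have "((\<lambda>t. x + t *\<^sub>R v) \<longlongrightarrow> x + 0 *\<^sub>R v) (at_right 0)"
      by (intro tendsto_intros)
    then have "\<forall>\<^sub>F t in at_right 0. x + t *\<^sub>R v \<in> interior S"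
      using x by (intro topological_tendstoD) auto
    moreover have "\<forall>\<^sub>F t in at_right (0::real). 0 < t"
      by (rule eventually_at_right_less)
    ultimately show ?thesis
    proof eventually_elim
      case (elim t)
      then have "x + t *\<^sub>R v \<in> S" using interior_subset by blast
      from mono[OF this] have "t * (t * (\<mu> * (norm v)\<^sup>2)) \<le> t * (v \<bullet> (G (x + t *\<^sub>R v) - G x))"
        by (simp add: power_mult_distrib power2_eq_square algebra_simps)
      then have "t * (\<mu> * (norm v)\<^sup>2) \<le> v \<bullet> (G (x + t *\<^sub>R v) - G x)"
        using elim(2) by simp
      then show ?case using elim(2) by (simp add: pos_le_divide_eq mult.commute)
    qed
  qed
  ultimately show ?thesis
    using tendsto_lowerbound trivial_limit_at_right_real by blast
qed

section \<open>Gradient and Hessian of the slices of a C2 function\<close>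

lemma GDERIV_unique:
  assumes "GDERIV g x :> D1" and "GDERIV g x :> D2"
  shows "D1 = D2"
proof -
  have "(\<lambda>h. h \<bullet> D1) = (\<lambda>h. h \<bullet> D2)"
    using assms unfolding gderiv_def by (rule has_derivative_unique)
  then show ?thesis by (metis vector_eq_ldot)
qed

text \<open>The derivatives \<open>f'\<close> and \<open>f''\<close> given by \<open>C2_on\<close>
  are functionals on the product space; restricting them to directions \<open>(h, 0)\<close>
  identifies \<open>grad_x\<close> and \<open>hess_x\<close>, which are defined by description and
  by \<open>jacobian\<close>, as genuine derivatives.\<close>

lemma C2_on_slice:
  fixes f :: "(real^'n) \<times> (real^'p) \<Rightarrow> real"
  assumes C2: "C2_on (UNIV \<times> U) f" and u: "u \<in> U"
  shows GDERIV_grad_x: "GDERIV (\<lambda>y. f (y, u)) y :> grad_x f y u"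
    and has_derivative_grad_x:
      "((\<lambda>y. grad_x f y u) has_derivative (\<lambda>h. hess_x f y u *v h)) (at y)"
    and continuous_on_hess_x: "continuous_on UNIV (\<lambda>y. v \<bullet> (hess_x f y u *v w))"
proof -
  from C2 obtain f' :: "(real^'n) \<times> (real^'p) \<Rightarrow> ((real^'n) \<times> (real^'p)) \<Rightarrow>\<^sub>L real"
    and f'' :: "(real^'n) \<times> (real^'p) \<Rightarrow> ((real^'n) \<times> (real^'p)) \<Rightarrow>\<^sub>L (((real^'n) \<times> (real^'p)) \<Rightarrow>\<^sub>L real)"
    where f': "\<And>z. z \<in> UNIV \<times> U \<Longrightarrow> (f has_derivative blinfun_apply (f' z)) (at z)"
      and f'': "\<And>z. z \<in> UNIV \<times> U \<Longrightarrow> (f' has_derivative blinfun_apply (f'' z)) (at z)"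
      and cont: "continuous_on (UNIV \<times> U) f''"
    unfolding C2_on_def by blast
  have pair: "((\<lambda>y::real^'n. (y, u)) has_derivative (\<lambda>h. (h, 0))) (at y)" for y
    by (auto intro!: derivative_eq_intros)
  \<comment> \<open>The Riesz representative of \<open>h \<mapsto> f' (y, u) (h, 0)\<close>.\<close>
  define G where "G y = (\<Sum>b\<in>Basis. f' (y, u) (b, 0) *\<^sub>R b)" for y
  \<comment> \<open>Stated for arbitrary \<open>F\<close> because it serves both
    \<open>f' (y, u)\<close> and, for the Hessian, \<open>f'' (y, u) (w, 0)\<close>.\<close>
  have expand: "h \<bullet> (\<Sum>b\<in>Basis. F (b, 0) *\<^sub>R b) = F (h, 0)"
    for F :: "((real^'n) \<times> (real^'p)) \<Rightarrow>\<^sub>L real" and h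
  proof -
    have "linear (\<lambda>h::real^'n. (h, 0::real^'p))"
      by (rule linearI) auto
    then have lin: "linear (\<lambda>h::real^'n. F (h, 0))"
      using linear_compose[of "\<lambda>h. (h, 0)" "blinfun_apply F"] blinfun.bounded_linear_right[of F]
      by (simp add: o_def bounded_linear.linear)
    have "F (h, 0) = F ((\<Sum>b\<in>Basis. (h \<bullet> b) *\<^sub>R b), 0)"
      by (simp add: euclidean_representation)
    also have "\<dots> = (\<Sum>b\<in>Basis. (h \<bullet> b) * F (b, 0))"
      using linear_sum[OF lin, of "\<lambda>b. (h \<bullet> b) *\<^sub>R b" Basis] linear_scale[OF lin] by simp
    finally show ?thesis
      by (simp add: inner_sum_right mult.commute)
  qed
  have grad: "GDERIV (\<lambda>y. f (y, u)) y :> G y" for y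
    unfolding gderiv_def G_def expand
    using has_derivative_compose[OF pair f'] u by simp
  have Gx: "grad_x f y u = G y" for y
    unfolding grad_x_def using grad GDERIV_unique by (metis the_equality)
  have dG: "(G has_derivative (\<lambda>h. \<Sum>b\<in>Basis. f'' (y, u) (h, 0) (b, 0) *\<^sub>R b)) (at y)" for y
  proof -
    have "((\<lambda>y. f' (y, u)) has_derivative (\<lambda>h. f'' (y, u) (h, 0))) (at y)"
      using has_derivative_compose[OF pair f''] u by simp
    then show ?thesis
      unfolding G_def by (auto intro!: derivative_eq_intros)
  qed
  have dgrad: "((\<lambda>y. grad_x f y u) has_derivative (\<lambda>h. \<Sum>b\<in>Basis. f'' (y, u) (h, 0) (b, 0) *\<^sub>R b)) (at y)"
    for y
    using dG by (simp add: Gx)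
  then have hess: "((\<lambda>y. grad_x f y u) has_derivative (\<lambda>h. hess_x f y u *v h)) (at y)" for y
    unfolding hess_x_def using jacobian_works differentiable_def by blast
  have "hess_x f y u *v h = (\<Sum>b\<in>Basis. f'' (y, u) (h, 0) (b, 0) *\<^sub>R b)" for y h
    using has_derivative_unique[OF hess dgrad] by metis
  then have eq: "v \<bullet> (hess_x f y u *v w) = f'' (y, u) (w, 0) (v, 0)" for y
    by (simp add: expand)
  have "continuous_on UNIV (\<lambda>y. f'' (y, u))"
    by (rule continuous_on_compose2[OF cont]) (use u in \<open>auto intro!: continuous_intros\<close>)
  then have "continuous_on UNIV (\<lambda>y. f'' (y, u) (w, 0) (v, 0))"
    by (intro continuous_intros)
  then show "continuous_on UNIV (\<lambda>y. v \<bullet> (hess_x f y u *v w))"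
    unfolding eq .
  show "GDERIV (\<lambda>y. f (y, u)) y :> grad_x f y u" by (simp add: Gx grad)
  show "((\<lambda>y. grad_x f y u) has_derivative (\<lambda>h. hess_x f y u *v h)) (at y)" by (rule hess)
qed

lemma hess_x_symmetric:
  fixes f :: "(real^'n) \<times> (real^'p) \<Rightarrow> real"
  assumes "C2_on (UNIV \<times> U) f" and "u \<in> U"
  shows "v \<bullet> (hess_x f y u *v w) = w \<bullet> (hess_x f y u *v v)"
  using second_derivative_symmetric[OF GDERIV_grad_x[OF assms] has_derivative_grad_x[OF assms]] .

text \<open>The iterate may lie on the bounding sphere, where not every direction stays in the ball.
  The bound is therefore taken on the open ball and extended to its closure by continuity of the
  Hessian.\<close>

lemma strongly_convex_hess_x_ge:
  fixes f :: "(real^'n) \<times> (real^'p) \<Rightarrow> real"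
  assumes C2: "C2_on (UNIV \<times> U) f" and u: "u \<in> U"
    and sc: "strongly_convex_on \<mu> (cball c e) (\<lambda>y. f (y, u))"
    and "0 < e" and y: "y \<in> cball c e"
  shows "\<mu> * (norm v)\<^sup>2 \<le> v \<bullet> (hess_x f y u *v v)"
proof (rule continuous_ge_on_closure[where f = "\<lambda>y. v \<bullet> (hess_x f y u *v v)"])
  show "continuous_on (closure (ball c e)) (\<lambda>y. v \<bullet> (hess_x f y u *v v))"
    using continuous_on_hess_x[OF C2 u] continuous_on_subset by blast
  show "y \<in> closure (ball c e)" using y \<open>0 < e\<close> by simp
  show "\<mu> * (norm v)\<^sup>2 \<le> v \<bullet> (hess_x f z u *v v)" if "z \<in> ball c e" for z
    by (rule strongly_convex_hessian_ge_interior[OF GDERIV_grad_x[OF C2 u] sc _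
          has_derivative_grad_x[OF C2 u]]) (use that in simp)
qed

section \<open>Row vectors and geometric convergence\<close>

lemma symmetric_vector_matrix_mult:
  fixes A :: "real^'n^'n"
  assumes "\<And>v w. v \<bullet> (A *v w) = w \<bullet> (A *v v)"
  shows "y v* A = A *v y"
  by (metis assms dot_lmul_matrix inner_commute vector_eq_rdot)

text \<open>A matrix and its transpose have the same operator norm: test \<open>A\<close> on the
  vector \<open>y v* A\<close> itself.\<close>

lemma norm_vector_matrix_mult_le:
  fixes A :: "real^'p^'n"
  assumes "\<And>s. norm (A *v s) \<le> c * norm s"
  shows "norm (y v* A) \<le> c * norm y"
proof (cases "y v* A = 0")
  case True
  then show ?thesis
  proof (cases "c \<ge> 0")
    \<comment> \<open>A negative \<open>c\<close> is excluded by evaluating the hypothesis at a unit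
      vector.\<close>
    case False
    obtain s :: "real^'p" where "norm s = 1" using vector_choose_size zero_le_one by blast
    then have "0 \<le> c" using assms[of s] norm_ge_zero by (metis mult.right_neutral order_trans)
    then show ?thesis using False by simp
  qed simp
next
  case False
  have "norm (y v* A) * norm (y v* A) = y \<bullet> (A *v (y v* A))"
    by (metis dot_lmul_matrix norm_eq_sqrt_inner real_sqrt_mult_self inner_ge_zero abs_of_nonneg)
  also have "\<dots> \<le> norm y * norm (A *v (y v* A))" by (rule norm_cauchy_schwarz)
  also have "\<dots> \<le> norm y * (c * norm (y v* A))" by (intro mult_left_mono assms) auto
  finally have "norm (y v* A) * norm (y v* A) \<le> (c * norm y) * norm (y v* A)"
    by (simp add: mult_ac)
  then show ?thesis using False by simp
qed

lemma geometric_bound_tendsto: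
  fixes X :: "nat \<Rightarrow> 'a::real_normed_vector"
  assumes "0 \<le> q" "q < 1" and "\<And>k. norm (X k - l) \<le> q ^ k * b"
  shows "X \<longlonglongrightarrow> l"
proof -
  have "(\<lambda>k. q ^ k) \<longlonglongrightarrow> 0" using assms(1,2) by (intro LIMSEQ_power_zero) simp
  then have "(\<lambda>k. q ^ k * b) \<longlonglongrightarrow> 0" by (rule tendsto_mult_left_zero)
  then have "(\<lambda>k. X k - l) \<longlonglongrightarrow> 0"
    by (rule Lim_null_comparison[rotated]) (simp add: assms(3))
  then show ?thesis by (simp add: LIM_zero_iff)
qed

section \<open>Convergence of the forward and reverse iterations\<close>

theorem mainTheorem3:
  fixes f :: "(real^'n) \<times> (real^'p) \<Rightarrow> real"
    and U :: "(real^'p) set"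
    and \<epsilon> m L :: "real^'p \<Rightarrow> real"
    and \<kappa> C \<alpha> :: real
    and a r :: "real^'n"
    and u s :: "real^'p"
    and x xhat :: "nat \<Rightarrow> real^'n"
    and xtilde :: "int \<Rightarrow> real^'n"
    and utilde :: "nat \<Rightarrow> real^'p"
    and K :: nat
    and R :: "real^'n^'n"
  assumes "open U" and "U \<noteq> {}" and "bounded U"
    and "C2_on (UNIV \<times> U) f"
    and "\<forall>v\<in>U. convex_on UNIV (\<lambda>y. f (y, v))"
    and "\<forall>v\<in>U. \<exists>!y. is_arg_min (\<lambda>y. f (y, v)) (\<lambda>_. True) y"
    and "\<forall>v\<in>U. positive_definite (hess_x f (minimizer f v) v)"
    and "\<forall>v\<in>U. 0 < \<epsilon> v \<and> 0 < m v
           \<and> strongly_convex_on (m v) (cball (minimizer f v) (\<epsilon> v)) (\<lambda>y. f (y, v))"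
    and "\<forall>v\<in>U. cball (minimizer f v) (\<epsilon> v) \<subseteq> level_set f a v"
    and "\<forall>v\<in>U. 0 < L v
           \<and> (\<forall>y\<in>level_set f a v. \<forall>l. is_eigenvalue (hess_x f y v) l \<longrightarrow> l \<le> L v)"
    and "0 < \<kappa>"
    and "\<forall>(y, v)\<in>level_graph f a U. matrix_opnorm (hess_xu f y v) \<le> \<kappa>"
    and "0 \<le> C" and "C-lipschitz_on (level_graph f a U) (D_grad_x f)"
    and "u \<in> U" and "0 < \<alpha>" and "\<alpha> \<le> 1 / L u"
    and "x 0 = a"
    and "\<forall>k. x (Suc k) = x k - \<alpha> *\<^sub>R grad_x f (x k) u"
    and "x K \<in> cball (minimizer f u) (\<epsilon> u)"
    and "R = mat 1 - \<alpha> *\<^sub>R hess_x f (x K) u"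
    and "xhat 0 = 0"
    and "\<forall>k. xhat (Suc k) = R *v xhat k - \<alpha> *\<^sub>R (hess_xu f (x K) u *v s)"
    and "utilde 0 = 0"
    and "\<forall>n. utilde (Suc n)
           = utilde n - \<alpha> *\<^sub>R (xtilde (int K - int n) v* hess_xu f (x K) u)"
    and "xtilde (int K) = r"
    and "\<forall>n::nat. xtilde (int K - int n - 1) = xtilde (int K - int n) v* R"
  shows "xhat \<longlonglongrightarrow> phi f (x K) u *v s
    \<and> utilde \<longlonglongrightarrow> r v* phi f (x K) u
    \<and> (\<exists>q::real. 0 \<le> q \<and> q < 1 \<and> (\<forall>k n::nat.
          norm (xhat k - phi f (x K) u *v s) \<le> q ^ k * (\<kappa> / m u) * norm s
        \<and> norm (utilde n - r v* phi f (x K) u) \<le> q ^ n * (\<kappa> / m u) * norm r))"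
proof -
  note C2 = assms(4) and scs = assms(8) and ball = assms(9) and Ls = assms(10) and kap = assms(12)
    and u = \<open>u \<in> U\<close> and \<alpha>pos = \<open>0 < \<alpha>\<close> and xK = \<open>x K \<in> cball (minimizer f u) (\<epsilon> u)\<close>
    and R = \<open>R = mat 1 - \<alpha> *\<^sub>R hess_x f (x K) u\<close>
  define H where "H = hess_x f (x K) u"
  define B where "B = hess_xu f (x K) u"
  define P where "P = phi f (x K) u"
  have pos: "0 < \<epsilon> u" "0 < m u" "0 < L u" and sc: "strongly_convex_on (m u) (cball (minimizer f u) (\<epsilon> u)) (\<lambda>y. f (y, u))"
    using scs Ls u by auto
  have lev: "x K \<in> level_set f a u" using ball u xK by blast
  have sym: "v \<bullet> (H *v w) = w \<bullet> (H *v v)" for v w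
    unfolding H_def by (rule hess_x_symmetric[OF C2 u])
  have ge: "m u * (norm v)\<^sup>2 \<le> v \<bullet> (H *v v)" for v
    unfolding H_def by (rule strongly_convex_hess_x_ge[OF C2 u sc pos(1) xK])
  \<comment> \<open>\<open>L u\<close> bounds eigenvalues only; the top eigenvalue of the symmetric
    \<open>H\<close> carries the bound over to the quadratic form.\<close>
  have le: "v \<bullet> (H *v v) \<le> L u * (norm v)\<^sup>2" for v
  proof -
    obtain l where l: "is_eigenvalue H l" "v \<bullet> (H *v v) \<le> l * (norm v)\<^sup>2"
      using symmetric_matrix_top_eigenvalue[OF sym] by metis
    have "l \<le> L u" using Ls u lev l(1) unfolding H_def by blast
    then show ?thesis using l(2) by (meson mult_right_mono order_trans zero_le_power2)
  qed
  have Bn: "norm (B *v s') \<le> \<kappa> * norm s'" for s'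
  proof -
    have "matrix_opnorm B \<le> \<kappa>"
      using kap u lev unfolding level_graph_def B_def by blast
    moreover have "norm (B *v s') \<le> matrix_opnorm B * norm s'"
      unfolding matrix_opnorm_def
      by (intro onorm matrix_vector_mul_bounded_linear)
    ultimately show ?thesis by (meson mult_right_mono norm_ge_zero order_trans)
  qed
  \<comment> \<open>This lower bound yields both the invertibility of \<open>H\<close> and, through
    \<open>H P = - B\<close>, the bound \<open>\<kappa> / m u\<close> on \<open>P\<close>, so the
    norm of the inverse is never estimated.\<close>
  have Hn: "m u * norm v \<le> norm (H *v v)" for v
  proof (cases "v = 0")
    case False
    have "norm v * (m u * norm v) \<le> norm v * norm (H *v v)"
      using ge[of v] norm_cauchy_schwarz[of v "H *v v"] by (simp add: power2_eq_square mult_ac)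
    then show ?thesis using False by simp
  qed simp
  have "v = 0" if "H *v v = 0" for v
    using Hn[of v] that pos(2) by (simp add: mult_le_0_iff)
  then have "invertible H"
    by (metis invertible_left_inverse matrix_left_invertible_ker)
  then have "H ** matrix_inv H = mat 1"
    unfolding invertible_def matrix_inv_def by (rule someI2_ex) blast
  have HP: "H *v (P *v s') = - (B *v s')" for s'
  proof -
    have "P *v s' = - (matrix_inv H *v (B *v s'))"
      unfolding P_def phi_def H_def[symmetric] B_def[symmetric]
      by (simp add: matrix_vector_mul_assoc) (simp add: matrix_vector_mult_def vec_eq_iff sum_negf)
    then have "H *v (P *v s') = - (H *v (matrix_inv H *v (B *v s')))"
      by (simp add: linear_neg[OF matrix_vector_mul_linear])
    then show ?thesis
      using \<open>H ** matrix_inv H = mat 1\<close> by (metis matrix_vector_mul_assoc matrix_vector_mul_lid)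
  qed
  have Pn: "norm (P *v s') \<le> \<kappa> / m u * norm s'" for s'
  proof -
    have "m u * norm (P *v s') \<le> \<kappa> * norm s'"
      using Hn[of "P *v s'"] Bn[of s'] by (simp add: HP)
    then show ?thesis using pos(2) by (simp add: field_simps)
  qed
  have Rv: "R *v v = v - \<alpha> *\<^sub>R (H *v v)" for v
    by (simp add: R H_def matrix_vector_mult_diff_rdistrib scaleR_matrix_vector_assoc)
  have symR: "v \<bullet> (R *v w) = w \<bullet> (R *v v)" for v w
    using sym[of v w] by (simp add: Rv inner_diff_right inner_commute)
  define q where "q = 1 - \<alpha> * m u"
  have "\<alpha> * L u \<le> 1"
    using \<open>\<alpha> \<le> 1 / L u\<close> pos(3) by (simp add: field_simps)
  have vRv: "v \<bullet> (R *v v) = (norm v)\<^sup>2 - \<alpha> * (v \<bullet> (H *v v))" for v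
    by (simp add: Rv inner_diff_right power2_norm_eq_inner)
  have Hlow: "\<alpha> * (m u * (norm v)\<^sup>2) \<le> \<alpha> * (v \<bullet> (H *v v))" for v
    using ge \<alpha>pos by simp
  have Hup: "\<alpha> * (v \<bullet> (H *v v)) \<le> (norm v)\<^sup>2" for v
  proof -
    have "\<alpha> * (v \<bullet> (H *v v)) \<le> \<alpha> * (L u * (norm v)\<^sup>2)" using le \<alpha>pos by simp
    also have "\<dots> = (\<alpha> * L u) * (norm v)\<^sup>2" by simp
    also have "\<dots> \<le> 1 * (norm v)\<^sup>2" by (intro mult_right_mono \<open>\<alpha> * L u \<le> 1\<close>) simp
    finally show ?thesis by simp
  qed
  have R0: "0 \<le> v \<bullet> (R *v v)" and Rq: "v \<bullet> (R *v v) \<le> q * (norm v)\<^sup>2" for v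
    using vRv[of v] Hlow[of v] Hup[of v] by (simp_all add: q_def algebra_simps)
  \<comment> \<open>This amounts to \<open>\<alpha> * m u \<le> 1\<close>; it follows because the
    form of \<open>R\<close> at a unit vector lies between 0 and \<open>q\<close>.\<close>
  have "0 \<le> q"
  proof -
    obtain v :: "real^'n" where "norm v = 1" using vector_choose_size zero_le_one by blast
    then show ?thesis using R0[of v] Rq[of v] by simp
  qed
  have "q < 1" using \<alpha>pos pos(2) by (simp add: q_def)
  have Rn: "norm (R *v v) \<le> q * norm v" for v
    by (rule selfadjoint_contraction[OF matrix_vector_mul_linear symR R0 Rq \<open>0 \<le> q\<close>])
  \<comment> \<open>Equivalently, \<open>P *v s\<close> is the fixed point of the forward
    recursion.\<close>
  have RP: "R *v (P *v s') = P *v s' + \<alpha> *\<^sub>R (B *v s')" for s'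
    by (simp add: Rv HP)

  have xh: "norm (xhat k - P *v s) \<le> q ^ k * (\<kappa> / m u * norm s)" for k
  proof (induction k)
    case 0
    then show ?case using Pn[of s] \<open>xhat 0 = 0\<close> by simp
  next
    case (Suc k)
    have "xhat (Suc k) - P *v s = R *v (xhat k - P *v s)"
      using assms(23) by (simp add: matrix_vector_mult_diff_distrib RP B_def)
    then have "norm (xhat (Suc k) - P *v s) \<le> q * norm (xhat k - P *v s)"
      using Rn by simp
    also have "\<dots> \<le> q * (q ^ k * (\<kappa> / m u * norm s))"
      by (intro mult_left_mono Suc.IH \<open>0 \<le> q\<close>)
    finally show ?case by (simp add: mult_ac)
  qed

  \<comment> \<open>Indexing by \<open>n\<close> instead of the possibly negative
    \<open>int K - int n\<close> permits plain induction; \<open>y n\<close> is \<open>r\<close>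
    multiplied \<open>n\<close> times by \<open>R\<close> from the right.\<close>
  define y where "y n = xtilde (int K - int n)" for n
  have y0: "y 0 = r" using \<open>xtilde (int K) = r\<close> by (simp add: y_def)
  have ySuc: "y (Suc n) = y n v* R" for n
  proof -
    have "int K - int (Suc n) = int K - int n - 1" by simp
    then show ?thesis unfolding y_def using assms(27) by metis
  qed
  have yn: "norm (y n) \<le> q ^ n * norm r" for n
  proof (induction n)
    case (Suc n)
    have "norm (y (Suc n)) \<le> q * norm (y n)"
      by (simp add: ySuc symmetric_vector_matrix_mult[OF symR] Rn)
    also have "\<dots> \<le> q * (q ^ n * norm r)" by (intro mult_left_mono Suc.IH \<open>0 \<le> q\<close>)
    finally show ?case by (simp add: mult_ac)
  qed (simp add: y0)
  \<comment> \<open>The row form of \<open>RP\<close>, obtained by pairing with an arbitrary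
    \<open>t\<close>.\<close>
  have RProw: "(w v* R) v* P = w v* P + \<alpha> *\<^sub>R (w v* B)" for w
  proof -
    have "((w v* R) v* P) \<bullet> t = (w v* P + \<alpha> *\<^sub>R (w v* B)) \<bullet> t" for t
      by (simp add: dot_lmul_matrix RP inner_add_left inner_add_right)
    then show ?thesis by (metis vector_eq_rdot)
  qed
  \<comment> \<open>The quantity \<open>utilde n + y n v* P\<close> is invariant: by
    \<open>RProw\<close>, the term subtracted from \<open>utilde n\<close> is exactly what
    \<open>y n v* P\<close> gains.\<close>
  have ut: "utilde n - r v* P = - (y n v* P)" for n
  proof (induction n)
    case 0
    then show ?case using \<open>utilde 0 = 0\<close> by (simp add: y0)
  next
    case (Suc n)
    have "utilde (Suc n) = utilde n - \<alpha> *\<^sub>R (y n v* B)"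
      using assms(25) by (simp add: y_def B_def)
    then show ?case using Suc.IH by (simp add: ySuc RProw algebra_simps)
  qed
  have un: "norm (utilde n - r v* P) \<le> q ^ n * (\<kappa> / m u * norm r)" for n
  proof -
    have "norm (utilde n - r v* P) = norm (y n v* P)" by (simp add: ut)
    also have "\<dots> \<le> \<kappa> / m u * norm (y n)"
      by (rule norm_vector_matrix_mult_le[OF Pn])
    also have "\<dots> \<le> \<kappa> / m u * (q ^ n * norm r)"
      using yn \<open>0 < \<kappa>\<close> pos(2) by (intro mult_left_mono) auto
    finally show ?thesis by (simp add: mult_ac)
  qed
  show ?thesis
    unfolding P_def[symmetric]
    using geometric_bound_tendsto[OF \<open>0 \<le> q\<close> \<open>q < 1\<close> xh]
      geometric_bound_tendsto[OF \<open>0 \<le> q\<close> \<open>q < 1\<close> un] xh un \<open>0 \<le> q\<close> \<open>q < 1\<close>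
    by (auto simp: mult.assoc intro!: exI[of _ q])
qed

end
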